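(* Let $p>3$ be a prime and let $j$ be a positive integer with $j\mid p-1$ and $\mathrm{ord}_p(-3)=\frac{p-1}{j}$. Then the permutations of $\mathbb{F}_p$ induced by $D_3(1,x)$ and by $D_{3p}(1,x)$ both have cycle type $\bigl(\underbrace{\tfrac{p-1}{j},\dots,\tfrac{p-1}{j}}_{j\text{ times}},1\bigr)$. In particular, if $-3$ is a primitive root modulo $p$, then the cycle type of both permutations is $(p-1,1)$.
   Context: The $n$th reversed Dickson polynomial of the first kind (with parameter $1$) is the integer-coefficient polynomial $D_n(1,x)$ defined by $D_0(1,x)=2$, $D_1(1,x)=1$, $D_n(1,x)=D_{n-1}(1,x)-x\,D_{n-2}(1,x)$ for $n\ge 2$. Coefficients are reduced modulo $p$ to regard it as a polynomial over $\mathbb{F}_p$. For an integer $a$ prime to $p$, $\mathrm{ord}_p(a)$ is the multiplicative order of $a$ modulo $p$. The cycle type of a permutation of $\mathbb{F}_p$ is the multiset of lengths of the cycles in its disjoint cycle decomposition, fixed points being counted as cycles of length $1$. *)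

theory Defs
  imports
    "HOL-Number_Theory.Number_Theory"
    "HOL-Computational_Algebra.Polynomial"
    "HOL-Combinatorics.Cycles"
    "HOL-Combinatorics.Orbits"
begin

fun rev_dickson :: "nat \<Rightarrow> int poly" where
  "rev_dickson 0 = 2"
| "rev_dickson (Suc 0) = 1"
| "rev_dickson (Suc (Suc n)) = rev_dickson (Suc n) - [:0, 1:] * rev_dickson n"

text \<open>
  The field with \<open>p\<close> elements is \<^term>\<open>residue_ring (int p)\<close>, whose elements are the integers
  \<open>0, \<dots>, p - 1\<close>.  The coefficients are reduced modulo \<open>p\<close> first, and the
  reduced polynomial is then evaluated modulo \<open>p\<close>.
\<close>

definition induced_map :: "nat \<Rightarrow> int poly \<Rightarrow> int \<Rightarrow> int" where
  "induced_map p f x = poly (map_poly (\<lambda>c. c mod int p) f) x mod int p"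

text \<open>
  The cycles of a permutation \<open>f\<close> of a finite set \<open>S\<close> are its orbits on \<open>S\<close>; a fixed point is
  an orbit of size \<open>1\<close>.  The definition is only meaningful if \<open>f\<close> is a bijection of \<open>S\<close>.
  Lemma \<open>cycle_type_disjoint_cycles\<close> below confirms that it agrees with the multiset of cycle
  lengths in any decomposition of \<open>f\<close> into disjoint cycles covering \<open>S\<close>.
\<close>

definition cycle_type :: "'a set \<Rightarrow> ('a \<Rightarrow> 'a) \<Rightarrow> nat multiset" where
  "cycle_type S f = image_mset card (mset_set (orbit f ` S))"

lemma orbit_eq_set_cycle:
  assumes cs: "distinct cs" and f: "\<And>x. x \<in> set cs \<Longrightarrow> f x = cycle_of_list cs x"
    and x: "x \<in> set cs"
  shows "orbit f x = set cs"
proof -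
  let ?c = "cycle_of_list cs"
  let ?l = "length cs"
  have l: "?l > 0" using x by (cases cs) auto
  have rot: "(?c ^^ n) (cs ! i) = cs ! ((n + i) mod ?l)" if "i < ?l" for n i
  proof -
    have "(?c ^^ n) (cs ! i) = map (?c ^^ n) cs ! i" using that by simp
    also have "\<dots> = rotate n cs ! i" by (simp add: cyclic_rotation[OF cs])
    also have "\<dots> = cs ! ((n + i) mod ?l)" using that by (simp add: nth_rotate)
    finally show ?thesis .
  qed
  obtain i where i: "i < ?l" "x = cs ! i" using x by (auto simp: in_set_conv_nth)
  have fn: "(f ^^ n) x = cs ! ((n + i) mod ?l)" for n
  proof (induction n)
    case 0
    then show ?case using i by simp
  next
    case (Suc n)
    have "(n + i) mod ?l < ?l" using l by simp
    with f[of "cs ! ((n + i) mod ?l)"] rot[of "(n + i) mod ?l" 1] Suc show ?case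
      by (simp add: mod_Suc_eq)
  qed
  show ?thesis
  proof (intro equalityI subsetI)
    fix y assume "y \<in> orbit f x"
    then show "y \<in> set cs" using fn l by (auto simp: orbit_altdef)
  next
    fix y assume "y \<in> set cs"
    then obtain k where k: "k < ?l" "y = cs ! k" by (auto simp: in_set_conv_nth)
    have "?l - i + k + i = ?l + k" using i by simp
    hence "(f ^^ (?l - i + k)) x = y" using fn[of "?l - i + k"] k by simp
    moreover have "?l - i + k > 0" using i by simp
    ultimately show "y \<in> orbit f x" by (auto simp: orbit_altdef)
  qed
qed

lemma cycle_of_list_id: "x \<notin> set cs \<Longrightarrow> cycle_of_list cs x = x"
  by (rule id_outside_supp)

lemma cycle_of_list_in: "x \<in> set cs \<Longrightarrow> cycle_of_list cs x \<in> set cs"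
  using cycle_permutes permutes_in_image by metis

lemma foldr_cycles_outside:
  "x \<notin> set (concat css) \<Longrightarrow> foldr (\<circ>) (map cycle_of_list css) id x = x"
  by (induction css) (auto simp: cycle_of_list_id)

lemma foldr_cycles_apply:
  assumes "distinct (concat css)" "cs \<in> set css" "x \<in> set cs"
  shows "foldr (\<circ>) (map cycle_of_list css) id x = cycle_of_list cs x"
  using assms
proof (induction css)
  case Nil
  then show ?case by simp
next
  case (Cons ds css)
  show ?case
  proof (cases "cs = ds")
    case True
    then have "x \<notin> set (concat css)" using Cons.prems by auto
    then have "foldr (\<circ>) (map cycle_of_list css) id x = x" by (rule foldr_cycles_outside)
    moreover have "foldr (\<circ>) (map cycle_of_list (ds # css)) id x =
        cycle_of_list ds (foldr (\<circ>) (map cycle_of_list css) id x)" by simp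
    ultimately show ?thesis using True by presburger
  next
    case False
    then have cs: "cs \<in> set css" using Cons.prems by simp
    then have "cycle_of_list cs x \<in> set (concat css)"
      using cycle_of_list_in[OF Cons.prems(3)] by auto
    then have "cycle_of_list cs x \<notin> set ds" using Cons.prems(1) by auto
    then show ?thesis using Cons cs by (simp add: cycle_of_list_id)
  qed
qed

lemma cycle_type_disjoint_cycles:
  assumes "distinct (concat css)" "[] \<notin> set css" "S = set (concat css)"
    and "\<And>x. x \<in> S \<Longrightarrow> f x = foldr (\<circ>) (map cycle_of_list css) id x"
  shows "cycle_type S f = mset (map length css)"
proof -
  have dist: "distinct cs" if "cs \<in> set css" for cs
    using assms(1) that by (simp add: distinct_concat_iff)
  have orb: "orbit f x = set cs" if "cs \<in> set css" "x \<in> set cs" for cs x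
  proof (rule orbit_eq_set_cycle[OF dist[OF that(1)] _ that(2)])
    fix y assume y: "y \<in> set cs"
    with that(1) have "y \<in> S" using assms(3) by auto
    then show "f y = cycle_of_list cs y"
      using assms(4) foldr_cycles_apply[OF assms(1) that(1) y] by simp
  qed
  have "orbit f ` S = set ` set css"
  proof (intro equalityI subsetI)
    fix B assume "B \<in> orbit f ` S"
    then show "B \<in> set ` set css" using orb assms(3) by auto
  next
    fix B assume "B \<in> set ` set css"
    then obtain cs where cs: "cs \<in> set css" "B = set cs" by auto
    then have "cs \<noteq> []" using assms(2) by auto
    then have "hd cs \<in> set cs" by simp
    then have "orbit f (hd cs) = B" using orb[OF cs(1)] cs(2) by simp
    moreover have "hd cs \<in> S" using \<open>hd cs \<in> set cs\<close> cs(1) assms(3) by auto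
    ultimately show "B \<in> orbit f ` S" by blast
  qed
  moreover have css: "distinct css" "inj_on set (set css)"
  proof -
    have "removeAll [] css = css" using assms(2) by simp
    then show "distinct css" using assms(1) by (simp add: distinct_concat_iff)
    show "inj_on set (set css)"
    proof (rule inj_onI)
      fix a b assume ab: "a \<in> set css" "b \<in> set css" "set a = set b"
      then have "set a \<noteq> {}" using assms(2) by auto
      have "set a \<inter> set b = {}" if "a \<noteq> b"
        using assms(1) ab that by (simp only: distinct_concat_iff) blast
      with ab(3) \<open>set a \<noteq> {}\<close> show "a = b" by auto
    qed
  qed
  ultimately have "cycle_type S f = image_mset card (image_mset set (mset_set (set css)))"
    by (simp add: cycle_type_def image_mset_mset_set)
  also have "\<dots> = image_mset (card \<circ> set) (mset css)"
    using css by (simp add: mset_set_set multiset.map_comp)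
  also have "\<dots> = image_mset length (mset css)"
    by (intro image_mset_cong) (simp add: dist distinct_card)
  finally show ?thesis by simp
qed

end

theory Submission
  imports Defs
begin

text \<open>
  Since \<open>D\<^sub>3(1,x) = 1 - 3x\<close>, and \<open>D\<^sub>3\<^sub>p \<equiv> D\<^sub>3\<^sup>p\<close> modulo \<open>p\<close>, both polynomials induce the affine map
  \<open>x \<mapsto> 1 - 3x\<close> by Fermat's little theorem.  This map has a unique fixed point \<open>u\<close> because \<open>p\<close> does
  not divide \<open>4\<close>, and its \<open>n\<close>th iterate multiplies \<open>x - u\<close> by \<open>(-3)\<^sup>n\<close>, so every other orbit has
  exactly \<open>ord\<^sub>p(-3)\<close> elements.
  For the congruence, write \<open>D\<^sub>n(1,x) = \<alpha>\<^sup>n + \<beta>\<^sup>n\<close> where \<open>\<alpha> + \<beta> = 1\<close> and \<open>\<alpha>\<beta> = x\<close>: pairing the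
  \<open>k\<close>th and the \<open>(p - k)\<close>th term of the binomial expansion of \<open>(\<alpha>\<^sup>n + \<beta>\<^sup>n)\<^sup>p\<close> turns the difference
  \<open>(\<alpha>\<^sup>n + \<beta>\<^sup>n)\<^sup>p - (\<alpha>\<^sup>n\<^sup>p + \<beta>\<^sup>n\<^sup>p)\<close>, doubled, into \<open>p\<close> times an integer.
\<close>

subsection \<open>Reversed Dickson polynomials modulo a prime\<close>

lemma poly_map_poly_mod:
  "poly (map_poly (\<lambda>c. c mod m) f) x mod m = poly f x mod (m::int)"
proof (induction f)
  case (pCons a f)
  have "poly (map_poly (\<lambda>c. c mod m) (pCons a f)) x mod m
      = (a + x * (poly (map_poly (\<lambda>c. c mod m) f) x mod m)) mod m"
    by (simp add: map_poly_pCons mod_simps) (metis mod_add_right_eq mod_mult_right_eq)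
  also have "\<dots> = poly (pCons a f) x mod m"
    by (simp only: pCons.IH) (simp, metis mod_add_right_eq mod_mult_right_eq)
  finally show ?case .
qed simp

lemma induced_map_eq: "induced_map p f x = poly f x mod int p"
  by (simp add: induced_map_def poly_map_poly_mod)

text \<open>Both \<alpha> and \<beta> are roots of t^2 - t + x, so their power sums obey the
  recurrence defining \<open>rev_dickson\<close>, with the same initial values 2 and 1.\<close>

lemma rev_dickson_closed_form:
  fixes \<alpha> \<beta> :: complex
  assumes "\<alpha> + \<beta> = 1" "\<alpha> * \<beta> = of_int x"
  shows "of_int (poly (rev_dickson n) x) = \<alpha> ^ n + \<beta> ^ n"
proof (induction n rule: rev_dickson.induct)
  case (3 n)
  have \<beta>: "\<beta> = 1 - \<alpha>" using assms(1) by (simp add: algebra_simps)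
  have "of_int (poly (rev_dickson (Suc (Suc n))) x)
      = (\<alpha> ^ Suc n + \<beta> ^ Suc n) - \<alpha> * \<beta> * (\<alpha> ^ n + \<beta> ^ n)"
    using 3 assms(2) by simp
  also have "\<dots> = \<alpha> ^ Suc (Suc n) + \<beta> ^ Suc (Suc n)"
    by (simp add: \<beta> algebra_simps)
  finally show ?case .
qed (use assms in simp_all)

lemma rev_dickson_roots:
  obtains \<alpha> \<beta> :: complex where "\<alpha> + \<beta> = 1" "\<alpha> * \<beta> = of_int x"
proof
  \<comment> \<open>A square root of the discriminant of t^2 - t + x.\<close>
  define s where "s = csqrt (1 - 4 * of_int x)"
  have "s * s = 1 - 4 * of_int x"
    using power2_csqrt[of "1 - 4 * of_int x"] by (simp add: s_def power2_eq_square)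
  then show "((1 + s) / 2) * ((1 - s) / 2) = of_int x"
    by (simp add: algebra_simps)
  show "(1 + s) / 2 + (1 - s) / 2 = 1"
    by (simp add: field_simps)
qed

text \<open>For i \<le> j, factoring out (\<alpha>\<beta>)^i = x^i leaves \<alpha>^k + \<beta>^k
  with k = j - i, an integer value of a Dickson polynomial. This makes the paired binomial terms
  below integers.\<close>

lemma symmetric_power_sum_Ints:
  fixes \<alpha> \<beta> :: complex
  assumes "\<alpha> + \<beta> = 1" "\<alpha> * \<beta> = of_int x"
  shows "\<alpha> ^ i * \<beta> ^ j + \<alpha> ^ j * \<beta> ^ i \<in> \<int>"
proof -
  have le: "\<alpha> ^ i * \<beta> ^ j + \<alpha> ^ j * \<beta> ^ i \<in> \<int>" if "i \<le> j" for i j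
  proof -
    from that obtain k where j: "j = i + k" by (auto simp: le_iff_add)
    have "\<alpha> ^ i * \<beta> ^ j + \<alpha> ^ j * \<beta> ^ i = (\<alpha> * \<beta>) ^ i * (\<alpha> ^ k + \<beta> ^ k)"
      by (simp add: j power_add power_mult_distrib algebra_simps)
    also have "\<dots> = of_int (x ^ i * poly (rev_dickson k) x)"
      using rev_dickson_closed_form[OF assms, of k] assms(2) by simp
    finally show ?thesis by (metis Ints_of_int)
  qed
  show ?thesis
    using le[of i j] le[of j i] by (cases "i \<le> j") (auto simp: add.commute)
qed

lemma rev_dickson_mult_prime_cong:
  assumes "prime p" "p \<noteq> 2"
  shows "[poly (rev_dickson (n * p)) x = poly (rev_dickson n) x ^ p] (mod int p)"
proof -
  obtain \<alpha> \<beta> :: complex where ab: "\<alpha> + \<beta> = 1" "\<alpha> * \<beta> = of_int x"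
    using rev_dickson_roots .
  define u v where "u = \<alpha> ^ n" and "v = \<beta> ^ n"
  have p: "p > 2" using assms prime_ge_2_nat[of p] by linarith
  have sym: "u ^ i * v ^ j + u ^ j * v ^ i \<in> \<int>" for i j
    using symmetric_power_sum_Ints[OF ab, of "n * i" "n * j"]
    by (simp add: u_def v_def power_mult)
  \<comment> \<open>The inner binomial coefficients are divisible by p; \<open>c k\<close> is the
    integer quotient.\<close>
  define c where "c k = int ((p choose k) div p)" for k
  have c: "of_nat (p choose k) = (of_nat p * of_int (c k) :: complex)" if "k \<in> {1..<p}" for k
  proof -
    have "p dvd (p choose k)"
      using that assms(1) by (intro dvd_choose_prime) auto
    then have "p choose k = p * ((p choose k) div p)" by simp
    then show ?thesis unfolding c_def of_int_of_nat_eq of_nat_mult[symmetric] by (rule arg_cong)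
  qed
  define g where "g k = of_nat (p choose k) * u ^ k * v ^ (p - k)" for k
  have "(u + v) ^ p = (\<Sum>k\<le>p. g k)"
    by (simp add: binomial_ring g_def)
  also have "{..p} = insert 0 (insert p {1..<p})" using p by auto
  also have "(\<Sum>k\<in>insert 0 (insert p {1..<p}). g k) = v ^ p + u ^ p + (\<Sum>k\<in>{1..<p}. g k)"
    using p by (simp add: g_def)
  finally have 1: "(u + v) ^ p = v ^ p + u ^ p + (\<Sum>k\<in>{1..<p}. g k)" .
  \<comment> \<open>A single term need not be an integer multiple of p, but its sum with the
    reflected term is. Adding the reflected sum pairs them at the cost of a factor 2.\<close>
  have "(\<Sum>k\<in>{1..<p}. g k) = (\<Sum>k\<in>{1..<p}. g (p - k))"
    by (rule sum.reindex_bij_witness[of _ "\<lambda>k. p - k" "\<lambda>k. p - k"]) auto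
  then have "2 * (\<Sum>k\<in>{1..<p}. g k) = (\<Sum>k\<in>{1..<p}. g k + g (p - k))"
    by (simp add: sum.distrib)
  also have "\<dots> = (\<Sum>k\<in>{1..<p}. of_nat p * (of_int (c k) * (u ^ k * v ^ (p - k) + u ^ (p - k) * v ^ k)))"
  proof (rule sum.cong)
    fix k assume k: "k \<in> {1..<p}"
    then have "p choose (p - k) = p choose k"
      by (intro binomial_symmetric[symmetric]) auto
    with k show "g k + g (p - k)
        = of_nat p * (of_int (c k) * (u ^ k * v ^ (p - k) + u ^ (p - k) * v ^ k))"
      by (simp add: g_def c algebra_simps)
  qed simp
  also have "\<dots> = of_nat p * (\<Sum>k\<in>{1..<p}. of_int (c k) * (u ^ k * v ^ (p - k) + u ^ (p - k) * v ^ k))"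
    by (simp add: sum_distrib_left)
  finally have 2: "2 * (\<Sum>k\<in>{1..<p}. g k)
      = of_nat p * (\<Sum>k\<in>{1..<p}. of_int (c k) * (u ^ k * v ^ (p - k) + u ^ (p - k) * v ^ k))" .
  have "(\<Sum>k\<in>{1..<p}. of_int (c k) * (u ^ k * v ^ (p - k) + u ^ (p - k) * v ^ k)) \<in> \<int>"
    by (intro Ints_sum Ints_mult sym Ints_of_int)
  then obtain z where
    z: "(\<Sum>k\<in>{1..<p}. of_int (c k) * (u ^ k * v ^ (p - k) + u ^ (p - k) * v ^ k)) = of_int z"
    by (elim Ints_cases)
  have D: "of_int (poly (rev_dickson n) x) = u + v"
    "of_int (poly (rev_dickson (n * p)) x) = u ^ p + v ^ p"
    using rev_dickson_closed_form[OF ab] by (simp_all add: u_def v_def power_mult)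
  have "of_int (2 * (poly (rev_dickson n) x ^ p - poly (rev_dickson (n * p)) x))
      = (of_int (int p * z) :: complex)"
    using 1 2 z by (simp add: D)
  then have "2 * (poly (rev_dickson n) x ^ p - poly (rev_dickson (n * p)) x) = int p * z"
    by (simp only: of_int_eq_iff)
  then have "int p dvd 2 * (poly (rev_dickson n) x ^ p - poly (rev_dickson (n * p)) x)"
    by simp
  \<comment> \<open>The factor 2 from the doubling cancels because p is odd.\<close>
  moreover have "coprime (int p) 2"
    using p assms(1) primes_coprime[of p 2] by (simp flip: coprime_int_iff)
  ultimately have "int p dvd poly (rev_dickson n) x ^ p - poly (rev_dickson (n * p)) x"
    using coprime_dvd_mult_right_iff by blast
  then show ?thesis
    using cong_iff_dvd_diff cong_sym by blast
qed

text \<open>The form x^p = x also covers multiples of p. The proof passes to the natural residue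
  \<open>b\<close> of x, since \<open>fermat_theorem\<close> is about natural numbers.\<close>

lemma fermat_little_int:
  assumes "prime p"
  shows "[x ^ p = x] (mod int p)"
proof -
  define b where "b = nat (x mod int p)"
  have p: "p > 0" using assms by (rule prime_gt_0_nat)
  then have b: "int b = x mod int p" by (simp add: b_def)
  have "[b ^ p = b] (mod p)"
  proof (cases "p dvd b")
    case True
    then have "p dvd b ^ p" using p by (simp add: dvd_power_same dvd_trans[OF _ dvd_power])
    with True show ?thesis by (simp add: cong_def dvd_eq_mod_eq_0)
  next
    case False
    have "[b ^ (p - 1) * b = 1 * b] (mod p)"
      using assms False by (intro cong_scalar_right fermat_theorem)
    then show ?thesis using p by (simp flip: power_Suc2)
  qed
  then have "[int b ^ p = int b] (mod int p)"
    using cong_int_iff[of "b ^ p" b p] by simp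
  then show ?thesis by (simp add: b cong_def power_mod)
qed

lemma poly_rev_dickson_3: "poly (rev_dickson 3) x = 1 - 3 * x"
  by (simp add: numeral_3_eq_3)

lemma induced_map_rev_dickson:
  assumes "prime p" "p > 3" "n \<in> {3, 3 * p}"
  shows "induced_map p (rev_dickson n) x = (1 - 3 * x) mod int p"
proof -
  have "[poly (rev_dickson (3 * p)) x = poly (rev_dickson 3) x] (mod int p)"
    using assms by (intro cong_trans[OF rev_dickson_mult_prime_cong fermat_little_int]) auto
  then show ?thesis
    using assms(3) by (auto simp: induced_map_eq poly_rev_dickson_3 cong_def)
qed

subsection \<open>Cycle type of an affine map\<close>

text \<open>The orbits of points other than u partition \<open>S - {u}\<close> into blocks of size
  d; counting elements gives the number of blocks.\<close>

lemma cycle_type_one_fixpoint: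
  assumes "finite S" "u \<in> S" "f u = u" "d > 0"
    and orb: "\<And>x. x \<in> S - {u} \<Longrightarrow> x \<in> orbit f x \<and> orbit f x \<subseteq> S - {u} \<and> card (orbit f x) = d"
  shows "cycle_type S f = replicate_mset ((card S - 1) div d) d + {#1#}"
proof -
  define C where "C = orbit f ` (S - {u})"
  have fin: "finite C" using assms(1) by (simp add: C_def)
  have eq: "orbit f y = orbit f x" if "x \<in> S - {u}" "y \<in> orbit f x" for x y
    using that orb by (meson cyclic_on_def orbit_cyclic_eq3)
  have "d * card C = card (\<Union>C)"
  proof (rule card_partition)
    show "finite (\<Union>C)"
      using orb assms(1) by (intro finite_subset[of "\<Union>C" S]) (auto simp: C_def)
    show "c1 \<inter> c2 = {}" if "c1 \<in> C" "c2 \<in> C" "c1 \<noteq> c2" for c1 c2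
      using that eq unfolding C_def by blast
  qed (use fin orb in \<open>auto simp: C_def\<close>)
  also have "\<Union>C = S - {u}" using orb by (auto simp: C_def)
  finally have "d * card C = card S - 1"
    using assms(1,2) by simp
  then have C: "card C = (card S - 1) div d" using \<open>d > 0\<close> by (metis nonzero_mult_div_cancel_left less_irrefl)
  have u: "orbit f u = {u}" using assms(3) by (simp add: orbit_eq_singleton_iff)
  have S: "orbit f ` S = insert {u} C"
    using assms(2) u by (auto simp: C_def)
  \<comment> \<open>Thus the fixed point contributes a separate 1, even when d = 1.\<close>
  have "{u} \<notin> C" using orb by (auto simp: C_def)
  then have "cycle_type S f = add_mset 1 (image_mset card (mset_set C))"
    by (simp add: cycle_type_def S fin)
  also have "image_mset card (mset_set C) = image_mset (\<lambda>_. d) (mset_set C)"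
    using fin orb by (intro image_mset_cong) (auto simp: C_def)
  finally show ?thesis by (simp add: image_mset_const_eq C)
qed

lemma affine_map_cycle_type:
  fixes p a :: nat and b :: int
  assumes "prime p" "\<not> p dvd a" "\<not> [a = 1] (mod p)"
  defines "f \<equiv> (\<lambda>x. (int a * x + b) mod int p)"
  shows "bij_betw f {0..<int p} {0..<int p}"
    and "cycle_type {0..<int p} f = replicate_mset ((p - 1) div ord p a) (ord p a) + {#1#}"
proof -
  define d where "d = ord p a"
  have p: "p > 0" "prime (int p)" using assms(1) prime_gt_0_nat by auto
  have cop: "coprime p a" using assms(1,2) by (simp add: prime_imp_coprime)
  have d: "d > 0" using cop by (simp add: d_def)
  have "\<not> int p dvd 1 - int a"
    using assms(3) cong_int_iff[of a 1 p] by (simp add: cong_iff_dvd_diff cong_sym_eq dvd_diff_commute)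
  then have "coprime (1 - int a) (int p)"
    using p by (metis prime_imp_coprime coprime_commute)
  then obtain w where w: "[(1 - int a) * w = 1] (mod int p)"
    using cong_solve_coprime_int by blast
  \<comment> \<open>The fixed point b / (1 - a), with \<open>w\<close> the inverse of 1 - a modulo
    p.\<close>
  define u where "u = (b * w) mod int p"
  have S: "x mod int p \<in> {0..<int p}" for x using p by simp
  have "[(1 - int a) * w * b = 1 * b] (mod int p)" by (rule cong_scalar_right[OF w])
  then have u: "[(1 - int a) * u = b] (mod int p)"
    by (simp add: u_def cong_def mod_simps ac_simps)
  have step: "[f x - u = int a * (x - u)] (mod int p)" for x
  proof -
    have "[int a * x + b - u = int a * x + (1 - int a) * u - u] (mod int p)"
      by (intro cong_diff cong_add cong_refl cong_sym[OF u])
    then show ?thesis by (simp add: f_def cong_def mod_simps algebra_simps)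
  qed
  have iter: "[(f ^^ n) x - u = int (a ^ n) * (x - u)] (mod int p)" for n x
  proof (induction n)
    case (Suc n)
    have "[(f ^^ Suc n) x - u = int a * ((f ^^ n) x - u)] (mod int p)"
      using step by simp
    also have "[int a * ((f ^^ n) x - u) = int a * (int (a ^ n) * (x - u))] (mod int p)"
      by (rule cong_scalar_left[OF Suc])
    finally show ?case by (simp add: mult.assoc)
  qed simp
  have uS: "u \<in> {0..<int p}" unfolding u_def by (rule S)
  have cong_eq: "x = y" if "[x - u = y - u] (mod int p)" "x \<in> {0..<int p}" "y \<in> {0..<int p}" for x y
  proof -
    have "[x = y] (mod int p)" using cong_add[OF that(1) cong_refl[of u]] by simp
    then show ?thesis using that(2,3) by (simp add: cong_def)
  qed
  have range: "f x \<in> {0..<int p}" for x unfolding f_def by (rule S)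
  have iterS: "(f ^^ n) x \<in> {0..<int p}" if "x \<in> {0..<int p}" for n x
    using that range by (cases n) auto
  have fu: "f u = u" using step[of u] uS range by (intro cong_eq) auto
  \<comment> \<open>Away from u the factor x - u is invertible and cancels, so iterates agree
    exactly when the powers of a do.\<close>
  have iter_eq: "(f ^^ m) x = (f ^^ n) x \<longleftrightarrow> [m = n] (mod d)" if x: "x \<in> {0..<int p} - {u}" for m n x
  proof -
    have "\<not> int p dvd x - u"
      using cong_eq[of x u] x uS by (auto simp: cong_iff_dvd_diff)
    then have cx: "coprime (x - u) (int p)"
      using p(2) by (metis prime_imp_coprime coprime_commute)
    have "(f ^^ m) x = (f ^^ n) x \<longleftrightarrow> [(f ^^ m) x - u = (f ^^ n) x - u] (mod int p)"
      using cong_eq iterS x by auto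
    also have "\<dots> \<longleftrightarrow> [int (a ^ m) * (x - u) = int (a ^ n) * (x - u)] (mod int p)"
      using iter[of m x] iter[of n x] by (simp only: cong_def)
    also have "\<dots> \<longleftrightarrow> [int (a ^ m) = int (a ^ n)] (mod int p)"
      using cx by (rule cong_mult_rcancel)
    also have "\<dots> \<longleftrightarrow> [m = n] (mod d)"
      unfolding cong_int_iff d_def by (rule order_divides_expdiff[OF cop])
    finally show ?thesis .
  qed
  have orb: "x \<in> orbit f x \<and> orbit f x \<subseteq> {0..<int p} - {u} \<and> card (orbit f x) = d"
    if x: "x \<in> {0..<int p} - {u}" for x
  proof (intro conjI)
    have per: "(f ^^ d) x = x" using iter_eq[OF x, of d 0] by (simp add: cong_def)
    then show self: "x \<in> orbit f x" using d unfolding orbit_altdef by force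
    have "u \<notin> orbit f x"
    proof
      assume "u \<in> orbit f x"
      then have "x \<in> orbit f u" by (rule orbit_swap[OF self])
      then show False using fu x orbit_eq_singleton_iff[of f u] by auto
    qed
    then show "orbit f x \<subseteq> {0..<int p} - {u}"
      using iterS x by (auto simp: orbit_altdef)
    \<comment> \<open>Periodicity reduces the orbit to the first d iterates, which are distinct by
      \<open>iter_eq\<close>.\<close>
    have "orbit f x = (\<lambda>m. (f ^^ m) x) ` {..<d}"
      using orbit_altdef_bounded[OF per d] by auto
    moreover have "inj_on (\<lambda>m. (f ^^ m) x) {..<d}"
      using iter_eq[OF x] by (intro inj_onI) (auto simp: cong_def)
    ultimately show "card (orbit f x) = d" by (simp add: card_image)
  qed
  show "cycle_type {0..<int p} f = replicate_mset ((p - 1) div ord p a) (ord p a) + {#1#}"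
    using cycle_type_one_fixpoint[OF _ uS fu d orb] by (simp add: d_def)
  \<comment> \<open>Each point lies in its own orbit and is therefore an image; a surjective
    self-map of a finite set is injective.\<close>
  have "{0..<int p} \<subseteq> f ` {0..<int p}"
  proof
    fix x assume x: "x \<in> {0..<int p}"
    then have "x \<in> orbit f x"
      using orb[of x] orbit_eq_singleton_iff[of f u] fu by (cases "x = u") auto
    moreover have "orbit f x \<subseteq> {0..<int p}"
      using iterS[OF x] by (auto simp only: orbit_altdef)
    ultimately show "x \<in> f ` {0..<int p}"
      by (cases rule: orbit.cases) (use x in auto)
  qed
  then show "bij_betw f {0..<int p} {0..<int p}"
    using range by (auto simp: bij_betw_def intro!: finite_surj_inj)
qed

text \<open>Coprimality and power congruences depend only on the residue of a. This links the order
  of the integer -3 to the natural multiplier of \<open>affine_map_cycle_type\<close>.\<close>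

lemma ord_int_eq:
  assumes "p > 0"
  shows "ord (int p) a = ord p (nat (a mod int p))"
proof -
  define b where "b = nat (a mod int p)"
  have b: "int b = a mod int p" using assms by (simp add: b_def)
  have "coprime (int p) a \<longleftrightarrow> coprime p b"
    using assms by (simp flip: coprime_int_iff add: b)
  moreover have "[a ^ n = 1] (mod int p) \<longleftrightarrow> [b ^ n = 1] (mod p)" for n
    using cong_int_iff[of "b ^ n" 1 p] by (simp add: b cong_def power_mod)
  ultimately show ?thesis
    by (simp add: ord_def flip: b_def)
qed

theorem theorem3p11:
  fixes p :: nat
  assumes "prime p" and "p > 3"
  shows "(\<forall>j::nat. j > 0 \<longrightarrow> j dvd p - 1 \<longrightarrow> ord (int p) (- 3) = (p - 1) div j \<longrightarrow>
           (\<forall>n \<in> {3, 3 * p}.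
              bij_betw (induced_map p (rev_dickson n))
                (carrier (residue_ring (int p))) (carrier (residue_ring (int p))) \<and>
              cycle_type (carrier (residue_ring (int p))) (induced_map p (rev_dickson n))
                = replicate_mset j ((p - 1) div j) + {#1#})) \<and>
         (residue_primroot p (nat ((- 3) mod int p)) \<longrightarrow>
           (\<forall>n \<in> {3, 3 * p}.
              bij_betw (induced_map p (rev_dickson n))
                (carrier (residue_ring (int p))) (carrier (residue_ring (int p))) \<and>
              cycle_type (carrier (residue_ring (int p))) (induced_map p (rev_dickson n))
                = {#p - 1, 1#}))"
proof -
  define b where "b = nat ((- 3) mod int p)"
  have b: "int b = (- 3) mod int p" using assms by (simp add: b_def)
  have p: "prime (int p)" using assms by simp
  have carrier: "carrier (residue_ring (int p)) = {0..<int p}"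
    by (auto simp: residue_ring_def)
  have "\<not> int p dvd 3" using assms zdvd_imp_le[of "int p" 3] by auto
  then have b0: "\<not> p dvd b"
    by (simp flip: int_dvd_int_iff add: b dvd_mod_iff)
  have "\<not> int p dvd 2" using assms zdvd_imp_le[of "int p" 2] by auto
  \<comment> \<open>If -3 were congruent to 1, then p would divide 4.\<close>
  then have "\<not> int p dvd 2 * 2" using prime_dvd_multD[OF p, of 2 2] by blast
  then have b1: "\<not> [b = 1] (mod p)"
    using cong_iff_dvd_diff[of "- 3" 1 "int p"]
    by (simp flip: cong_int_iff add: b)
  have "induced_map p (rev_dickson n) = (\<lambda>x. (int b * x + 1) mod int p)" if "n \<in> {3, 3 * p}" for n
  proof
    fix x
    have "(int b * x + 1) mod int p = (- 3 * x + 1) mod int p"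
      unfolding b by (metis mod_add_left_eq mod_mult_left_eq)
    then show "induced_map p (rev_dickson n) x = (int b * x + 1) mod int p"
      using induced_map_rev_dickson[OF assms that, of x] by simp
  qed
  then have main: "bij_betw (induced_map p (rev_dickson n)) {0..<int p} {0..<int p}"
    "cycle_type {0..<int p} (induced_map p (rev_dickson n))
      = replicate_mset ((p - 1) div ord p b) (ord p b) + {#1#}" if "n \<in> {3, 3 * p}" for n
    using affine_map_cycle_type[OF assms(1) b0 b1, of 1] that by simp_all
  have ord: "ord (int p) (- 3) = ord p b"
    using assms ord_int_eq[of p "- 3"] by (simp add: b_def)
  \<comment> \<open>Turns the number of nontrivial orbits, p - 1 divided by the order, into
    j.\<close>
  have "(p - 1) div ((p - 1) div j) = j" if "j > 0" "j dvd p - 1" for j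
  proof -
    from that(2) obtain k where k: "p - 1 = j * k" ..
    with assms(2) have "k > 0" by (intro Nat.gr0I) auto
    with k that(1) show ?thesis by simp
  qed
  moreover have "ord p b = p - 1" if "residue_primroot p b"
    using that assms by (simp add: residue_primroot_def totient_prime)
  ultimately show ?thesis
    using assms main ord unfolding carrier b_def[symmetric] by (auto simp: add_mset_commute)
qed

end
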